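(* Let $n$ be a nonnegative integer, and let $A$ be a square matrix of size $n$ (with entries in a commutative ring containing $\lambda$). Then $$\operatorname{Pf}_\lambda\begin{pmatrix}O_n&A\\-A^T&O_n\end{pmatrix}=(-\lambda)^{n(n-1)/2}\det A,$$ where $O_n$ is the zero matrix of size $n$ and $A^T$ is the transpose of $A$.
   Context: For a skew-symmetric matrix $B$ of size $2n$, the $\lambda$-Pfaffian is $$\operatorname{Pf}_\lambda(B)=\sum_{m\in\mathcal M([2n])}(-1)^{\mathrm{cross}(m)}\,\lambda^{\mathrm{cross}(m)+\mathrm{nest}(m)}\prod_{i=1}^n B_{m_{2i-1}m_{2i}},$$ with $\operatorname{Pf}_\lambda$ of the empty matrix equal to $1$. Here $\mathcal M([2n])$ is the set of perfect matchings of $[2n]=\{1,\dots,2n\}$, written $m=((m_1,m_2),\dots,(m_{2n-1},m_{2n}))$ with $m_{2i-1}<m_{2i}$ for all $i$ and $m_1<m_3<\cdots<m_{2n-1}$. $\mathrm{cross}(m)$ is the number of (unordered) pairs of pairs $(a,b),(c,d)$ in $m$ with $a<c<b<d$; $\mathrm{nest}(m)$ is the number of pairs of pairs $(a,b),(c,d)$ in $m$ with $a<c<d<b$. *)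

theory Defs
  imports "Jordan_Normal_Form.Determinant"
begin

text \<open>
  A perfect matching of a linearly ordered vertex set is the set of its edges, each edge being
  written as a pair whose smaller endpoint comes first. This normal form is unique,
  so every matching occurs exactly once; listing the edges by increasing first component
  gives the sequence notation $((m_1,m_2),\dots,(m_{2n-1},m_{2n}))$.
\<close>

definition perfect_matchings :: "'v::linorder set \<Rightarrow> ('v \<times> 'v) set set" where
  "perfect_matchings V = {m. m \<subseteq> V \<times> V \<and> (\<forall>(a, b) \<in> m. a < b) \<and>
     (\<forall>v \<in> V. \<exists>!e. e \<in> m \<and> (v = fst e \<or> v = snd e))}"

text \<open>
  The inequality \<open>a < c\<close> fixes the order of the two edges, so every unordered pair of edges
  is counted at most once.
\<close>

definition cross :: "('v::linorder \<times> 'v) set \<Rightarrow> nat" where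
  "cross m = card {((a, b), (c, d)). (a, b) \<in> m \<and> (c, d) \<in> m \<and> a < c \<and> c < b \<and> b < d}"

definition nest :: "('v::linorder \<times> 'v) set \<Rightarrow> nat" where
  "nest m = card {((a, b), (c, d)). (a, b) \<in> m \<and> (c, d) \<in> m \<and> a < c \<and> c < d \<and> d < b}"

text \<open>
  Matrix indices start at 0, so the vertex set is \<open>{0..<2 * n}\<close> in place of $\{1,\dots,2n\}$.
  The definition is meant for skew-symmetric \<open>B\<close> of even size.
\<close>

definition lambda_Pfaffian :: "'a::comm_ring_1 \<Rightarrow> 'a mat \<Rightarrow> 'a" where
  "lambda_Pfaffian l B = (\<Sum>m \<in> perfect_matchings {0..<dim_row B}.
     (-1) ^ cross m * l ^ (cross m + nest m) * (\<Prod>(a, b) \<in> m. B $$ (a, b)))"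

lemma finite_perfect_matchings: "finite V \<Longrightarrow> finite (perfect_matchings V)"
  by (rule finite_subset[of _ "Pow (V \<times> V)"]) (auto simp: perfect_matchings_def)

lemma lambda_Pfaffian_empty: "dim_row B = 0 \<Longrightarrow> lambda_Pfaffian l B = 1"
proof -
  assume "dim_row B = 0"
  moreover have "perfect_matchings ({} :: nat set) = {{}}"
    by (auto simp: perfect_matchings_def)
  ultimately show ?thesis
    by (simp add: lambda_Pfaffian_def cross_def nest_def case_prod_unfold)
qed

end

theory Submission
  imports Defs
begin

text \<open>
  A matching contributes only if each of its edges joins some \<open>i < n\<close> to some \<open>n + p i\<close>;
  such matchings correspond to the permutations \<open>p\<close>. Two of these edges always overlap: they are
  nested if they form an inversion of \<open>p\<close>, and they cross otherwise. Hence every such matching has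
  \<open>cross + nest = n(n - 1)/2\<close>, and the sign \<open>(-1)^cross\<close> is \<open>(-1)^(n(n - 1)/2) sign p\<close>.
\<close>

section \<open>Inversions and the sign of a permutation\<close>

definition pairs_below :: "nat \<Rightarrow> (nat \<times> nat) set" where
  "pairs_below n = {(i, j). i < j \<and> j < n}"

definition inversions :: "nat \<Rightarrow> (nat \<Rightarrow> nat) \<Rightarrow> (nat \<times> nat) set" where
  "inversions n p = {(i, j) \<in> pairs_below n. p j < p i}"

lemma finite_pairs_below [simp]: "finite (pairs_below n)"
  by (rule finite_subset[of _ "{0..<n} \<times> {0..<n}"]) (auto simp: pairs_below_def)

lemma finite_inversions [simp]: "finite (inversions n p)"
  by (rule finite_subset[OF _ finite_pairs_below[of n]]) (auto simp: inversions_def)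

lemma card_pairs_below: "card (pairs_below n) = n * (n - 1) div 2"
proof (induction n)
  case 0
  then show ?case by (simp add: pairs_below_def)
next
  case (Suc n)
  have "pairs_below (Suc n) = pairs_below n \<union> (\<lambda>i. (i, n)) ` {0..<n}"
    by (auto simp: pairs_below_def less_Suc_eq)
  also have "card \<dots> = card (pairs_below n) + card ((\<lambda>i. (i, n)) ` {0..<n})"
    by (rule card_Un_disjoint[OF finite_pairs_below]) (auto simp: pairs_below_def)
  also have "card ((\<lambda>i. (i, n)) ` {0..<n}) = n"
    by (simp add: card_image inj_on_def)
  \<comment> \<open>The case split takes care of the truncated difference \<open>n - 1\<close> at
    \<open>n = 0\<close>.\<close>
  finally show ?case
    using Suc by (cases n) (auto simp: algebra_simps)
qed

text \<open>The parity of the number of inversions, written as a product over pairs so that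
  composition can be treated factor by factor.\<close>

definition inversion_sign :: "nat \<Rightarrow> (nat \<Rightarrow> nat) \<Rightarrow> int" where
  "inversion_sign n p = (\<Prod>(i, j) \<in> pairs_below n. if p j < p i then - 1 else 1)"

lemma inversion_sign_card: "inversion_sign n p = (- 1) ^ card (inversions n p)"
proof -
  have "inversion_sign n p = (\<Prod>e \<in> pairs_below n. if e \<in> inversions n p then - 1 else 1)"
    unfolding inversion_sign_def by (rule prod.cong) (auto simp: inversions_def split: if_splits)
  also have "\<dots> = (\<Prod>e \<in> pairs_below n \<inter> inversions n p. - 1)"
    by (subst prod.inter_restrict) auto
  also have "pairs_below n \<inter> inversions n p = inversions n p"
    by (auto simp: inversions_def)
  finally show ?thesis by simp
qed

text \<open>For \<open>i < j\<close> the composite inverts the pair iff exactly one of these holds: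
  \<open>q\<close> inverts \<open>(i, j)\<close>, or \<open>p\<close> inverts the sorted pair of
  \<open>q i\<close> and \<open>q j\<close>. As \<open>(i, j)\<close> varies, the sorted pair runs
  exactly once through all pairs, so the factors coming from \<open>p\<close> multiply to the
  inversion sign of \<open>p\<close>.\<close>

lemma inversion_sign_compose:
  assumes p: "p permutes {0..<n}" and q: "q permutes {0..<n}"
  shows "inversion_sign n (p \<circ> q) = inversion_sign n p * inversion_sign n q"
proof -
  \<comment> \<open>\<open>s q e\<close> is the image of the pair \<open>e\<close> under
    \<open>q\<close>, sorted again; \<open>h p e\<close> is the factor of \<open>e\<close> in the
    product for \<open>p\<close>.\<close>
  define s where "s q e = (min (q (fst e)) (q (snd e)), max (q (fst e)) (q (snd e)))"
    for q :: "nat \<Rightarrow> nat" and e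
  define h where "h p e = (if p (snd e) < p (fst e) then - 1 else 1 :: int)"
    for p :: "nat \<Rightarrow> nat" and e
  have sign_h: "inversion_sign n p = (\<Prod>e \<in> pairs_below n. h p e)" for p
    unfolding inversion_sign_def h_def by (rule prod.cong) auto
  have s_in: "s q e \<in> pairs_below n" if "q permutes {0..<n}" "e \<in> pairs_below n" for q e
  proof -
    obtain i j where e: "e = (i, j)" by (cases e)
    with that have ij: "i < j" "j < n" by (auto simp: pairs_below_def)
    then have "q i \<noteq> q j" using permutes_inj[OF that(1)] by (auto dest: injD)
    moreover have "q i < n" "q j < n"
      using permutes_in_image[OF that(1), of i] permutes_in_image[OF that(1), of j] ij by auto
    ultimately show ?thesis by (auto simp: s_def e pairs_below_def)
  qed
  \<comment> \<open>Sorting loses nothing, since \<open>e\<close> is increasing to begin with. This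
    serves \<open>q\<close> and its inverse in both orders.\<close>
  have s_inverse: "s r (s q e) = e"
    if "\<And>x. r (q x) = x" "e \<in> pairs_below n" for r q e
    using that by (auto simp: s_def pairs_below_def min_def max_def)
  note q' = permutes_inv[OF q]
  have reindex: "(\<Prod>e \<in> pairs_below n. h p (s q e)) = (\<Prod>e \<in> pairs_below n. h p e)"
    by (rule prod.reindex_bij_witness[where i = "s (inv_into UNIV q)" and j = "s q"])
       (auto intro!: s_in s_inverse q q' simp: permutes_inverses[OF q])
  have "h (p \<circ> q) e = h p (s q e) * h q e" if "e \<in> pairs_below n" for e
  proof -
    obtain i j where e: "e = (i, j)" by (cases e)
    with that have "i \<noteq> j" by (auto simp: pairs_below_def)
    then have "q i \<noteq> q j" "p (q i) \<noteq> p (q j)"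
      using permutes_inj[OF p] permutes_inj[OF q] by (auto dest: injD)
    then show ?thesis by (auto simp: e s_def h_def min_def max_def)
  qed
  then have "inversion_sign n (p \<circ> q) = (\<Prod>e \<in> pairs_below n. h p (s q e) * h q e)"
    unfolding sign_h by (rule prod.cong[OF refl])
  also have "\<dots> = inversion_sign n p * inversion_sign n q"
    unfolding prod.distrib reindex sign_h ..
  finally show ?thesis .
qed

text \<open>The inverted pairs are \<open>(a, k)\<close> with \<open>a < k \<le> b\<close> and
  \<open>(k, b)\<close> with \<open>a < k < b\<close>. The pair \<open>(a, b)\<close> is counted
  only in the first family, so the total is odd.\<close>

lemma inversion_sign_transpose:
  assumes "a < b" "b < n"
  shows "inversion_sign n (transpose a b) = - 1"
proof -
  have "inversions n (transpose a b) = Pair a ` {a<..b} \<union> (\<lambda>k. (k, b)) ` {a<..<b}"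
    using assms by (auto simp: inversions_def pairs_below_def transpose_def split: if_splits)
  also have "card \<dots> = card (Pair a ` {a<..b}) + card ((\<lambda>k. (k, b)) ` {a<..<b})"
    by (rule card_Un_disjoint) auto
  also have "\<dots> = (b - a) + (b - a - 1)"
    by (simp add: card_image inj_on_def)
  also have "\<dots> = Suc (2 * (b - a - 1))"
    using assms by simp
  finally show ?thesis by (simp add: inversion_sign_card)
qed

text \<open>Both sides are multiplicative and equal \<open>- 1\<close> at a transposition of
  distinct points, so induction on products of transpositions applies.\<close>

lemma sign_eq_inversions:
  assumes "p permutes {0..<n}"
  shows "sign p = (- 1) ^ card (inversions n p)"
  using assms finite_atLeastLessThan
proof (induction p rule: permutes_induct)
  case id
  have "inversions n (\<lambda>x. x) = {}" by (auto simp: inversions_def pairs_below_def)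
  then show ?case by (simp add: id_def)
next
  case (swap a b p)
  have t: "transpose a b permutes {0..<n}"
    by (rule permutes_swap_id) (use swap in auto)
  have "inversion_sign n (transpose a b) = - 1"
    using inversion_sign_transpose[of a b n] inversion_sign_transpose[of b a n] swap
    by (cases a b rule: linorder_cases) (auto simp: transpose_commute)
  then have "inversion_sign n (transpose a b \<circ> p) = sign (transpose a b) * sign p"
    using swap by (simp only: inversion_sign_compose[OF t] sign_swap_id if_False
        flip: inversion_sign_card)
  also have "\<dots> = sign (transpose a b \<circ> p)"
    using t \<open>p permutes _\<close>
    by (intro sign_compose[symmetric]) (auto intro: permutes_imp_permutation[rotated])
  finally show ?case unfolding inversion_sign_card ..
qed

section \<open>Bipartite perfect matchings and permutations\<close>

definition perm_matching :: "nat \<Rightarrow> (nat \<Rightarrow> nat) \<Rightarrow> (nat \<times> nat) set" where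
  "perm_matching n p = (\<lambda>i. (i, n + p i)) ` {0..<n}"

lemma mem_perm_matching [simp]: "(a, b) \<in> perm_matching n p \<longleftrightarrow> a < n \<and> b = n + p a"
  by (auto simp: perm_matching_def)

lemma perm_matching_in_perfect_matchings:
  assumes p: "p permutes {0..<n}"
  shows "perm_matching n p \<in> perfect_matchings {0..<2 * n}"
proof -
  have lt: "p i < n" if "i < n" for i
    using permutes_in_image[OF p, of i] that by simp
  have "\<exists>!e. e \<in> perm_matching n p \<and> (v = fst e \<or> v = snd e)" if "v < 2 * n" for v
  proof (cases "v < n")
    case True
    then show ?thesis
      by (intro ex1I[of _ "(v, n + p v)"]) auto
  next
    case False
    \<comment> \<open>The only edge at a vertex \<open>v\<close> of the upper half starts at the
      preimage of \<open>v - n\<close>: surjectivity of \<open>p\<close> provides it, injectivity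
      makes it unique.\<close>
    define i where "i = inv_into UNIV p (v - n)"
    have pi: "p i = v - n" by (simp add: i_def permutes_inverses[OF p])
    then have i: "i < n"
      using permutes_in_image[OF p, of i] that False by auto
    have iv: "(i, v) \<in> perm_matching n p"
      using i pi False by simp
    have "e = (i, v)" if e: "e \<in> perm_matching n p" "v = fst e \<or> v = snd e" for e
    proof -
      from e obtain j where j: "e = (j, n + p j)" "j < n"
        by (auto simp: perm_matching_def)
      with e(2) False have "v = n + p j" by auto
      with pi have "p j = p i" by simp
      with permutes_inj[OF p] have "j = i" by (rule injD)
      with j \<open>v = n + p j\<close> show ?thesis by simp
    qed
    with iv show ?thesis
      by (intro ex1I[of _ "(i, v)"]) simp_all
  qed
  moreover have "perm_matching n p \<subseteq> {0..<2 * n} \<times> {0..<2 * n}"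
    using lt by (fastforce simp: perm_matching_def)
  ultimately show ?thesis
    by (auto simp: perfect_matchings_def)
qed

lemma inj_on_perm_matching: "inj_on (perm_matching n) {p. p permutes {0..<n}}"
proof (rule inj_onI, rule ext, unfold mem_Collect_eq)
  fix p q x
  assume p: "p permutes {0..<n}" and q: "q permutes {0..<n}"
    and eq: "perm_matching n p = perm_matching n q"
  show "p x = q x"
  proof (cases "x < n")
    case True
    then have "(x, n + p x) \<in> perm_matching n q" by (simp flip: eq)
    then show ?thesis by simp
  next
    case False
    then show ?thesis using permutes_not_in[OF p] permutes_not_in[OF q] by simp
  qed
qed

lemma perfect_matching_covers:
  assumes "m \<in> perfect_matchings V" "v \<in> V"
  obtains a b where "(a, b) \<in> m" "v = a \<or> v = b"
proof -
  have "\<exists>!e. e \<in> m \<and> (v = fst e \<or> v = snd e)"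
    using assms by (simp add: perfect_matchings_def)
  then obtain e where "e \<in> m" "v = fst e \<or> v = snd e" by blast
  then show ?thesis by (intro that[of "fst e" "snd e"]) simp_all
qed

text \<open>For the map read off a bipartite matching, the case of equal second components yields
  injectivity, and the case of equal first components shows that the matching has no further
  edges.\<close>

lemma perfect_matching_edge_unique:
  assumes m: "m \<in> perfect_matchings V" and e: "(a, b) \<in> m" "(c, d) \<in> m"
    and common: "a = c \<or> b = d"
  shows "(a, b) = (c, d)"
proof -
  have ex1: "\<exists>!e. e \<in> m \<and> (v = fst e \<or> v = snd e)" if "v \<in> V" for v
    using m that by (simp add: perfect_matchings_def)
  have "a \<in> V" "b \<in> V"
    using m e(1) by (auto simp: perfect_matchings_def)
  from common show ?thesis
  proof
    assume "a = c"
    then show ?thesis using ex1[OF \<open>a \<in> V\<close>] e by (metis fst_conv)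
  next
    assume "b = d"
    then show ?thesis using ex1[OF \<open>b \<in> V\<close>] e by (metis snd_conv)
  qed
qed

text \<open>Each \<open>i < n\<close> is covered by an edge, which by \<open>bip\<close> must start
  at \<open>i\<close> and end in the upper half. This defines a map of \<open>{0..<n}\<close> into
  itself; it is injective, hence bijective by finiteness.\<close>

lemma bipartite_matching_is_perm_matching:
  assumes m: "m \<in> perfect_matchings {0..<2 * n}"
    and bip: "\<And>a b. (a, b) \<in> m \<Longrightarrow> a < n \<and> n \<le> b"
  obtains p where "p permutes {0..<n}" "m = perm_matching n p"
proof -
  have sub: "m \<subseteq> {0..<2 * n} \<times> {0..<2 * n}"
    using m by (auto simp: perfect_matchings_def)
  have "\<exists>k. k < n \<and> (i, n + k) \<in> m" if "i < n" for i
  proof -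
    obtain a b where ab: "(a, b) \<in> m" "i = a \<or> i = b"
      using perfect_matching_covers[OF m, of i] \<open>i < n\<close> by auto
    with bip[OF ab(1)] sub \<open>i < n\<close> have "i = a" "n \<le> b" "b < 2 * n" by auto
    with ab show ?thesis by (intro exI[of _ "b - n"]) auto
  qed
  then obtain f where f: "\<And>i. i < n \<Longrightarrow> f i < n" "\<And>i. i < n \<Longrightarrow> (i, n + f i) \<in> m"
    by metis
  have "inj_on f {0..<n}"
  proof (rule inj_onI)
    fix i j assume "i \<in> {0..<n}" "j \<in> {0..<n}" "f i = f j"
    then show "i = j"
      using perfect_matching_edge_unique[OF m f(2)[of i] f(2)[of j]] by simp
  qed
  moreover have "f ` {0..<n} \<subseteq> {0..<n}" using f by auto
  ultimately have bij: "bij_betw f {0..<n} {0..<n}"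
    by (simp add: bij_betw_def endo_inj_surj)
  \<comment> \<open>\<open>f\<close> is unconstrained outside \<open>{0..<n}\<close>, where a
    permutation of that set must be the identity.\<close>
  define p where "p i = (if i < n then f i else i)" for i
  have "bij_betw p {0..<n} {0..<n}"
    using bij by (subst bij_betw_cong[where g = f]) (auto simp: p_def)
  then have "p permutes {0..<n}"
    by (rule bij_imp_permutes) (auto simp: p_def)
  moreover have "m = perm_matching n p"
  proof (rule Set.set_eqI, clarify)
    fix a b
    have "b = n + f a" if "(a, b) \<in> m" "a < n"
      using perfect_matching_edge_unique[OF m that(1) f(2)[OF that(2)]] by simp
    with bip[of a b] show "(a, b) \<in> m \<longleftrightarrow> (a, b) \<in> perm_matching n p"
      by (auto simp: p_def f)
  qed
  ultimately show ?thesis by (rule that)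
qed

section \<open>Nestings and crossings of the matching of a permutation\<close>

lemma nest_perm_matching: "nest (perm_matching n p) = card (inversions n p)"
proof -
  let ?g = "\<lambda>(i, k). ((i, n + p i), (k, n + p k))"
  \<comment> \<open>For \<open>c = k < n\<close> the condition \<open>c < d\<close> is automatic,
    and \<open>d < b\<close> says \<open>p k < p i\<close>.\<close>
  have "{((a, b), (c, d)). (a, b) \<in> perm_matching n p \<and> (c, d) \<in> perm_matching n p
      \<and> a < c \<and> c < d \<and> d < b} = ?g ` inversions n p"
    by (auto simp: inversions_def pairs_below_def image_iff)
  moreover have "inj_on ?g (inversions n p)" by (auto simp: inj_on_def)
  ultimately show ?thesis by (simp add: nest_def card_image)
qed

text \<open>Here \<open>c < b\<close> is automatic because \<open>c < n \<le> b\<close>, and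
  \<open>b < d\<close> says \<open>p i < p k\<close>; by injectivity of \<open>p\<close> this is the
  negation of being an inversion.\<close>

lemma cross_perm_matching:
  assumes p: "p permutes {0..<n}"
  shows "cross (perm_matching n p) = card (pairs_below n - inversions n p)"
proof -
  let ?g = "\<lambda>(i, k). ((i, n + p i), (k, n + p k))"
  have "p i < p k" if "i < k" "\<not> p k < p i" for i k
    using injD[OF permutes_inj[OF p], of i k] that by (cases "p i" "p k" rule: linorder_cases) auto
  then have "{((a, b), (c, d)). (a, b) \<in> perm_matching n p \<and> (c, d) \<in> perm_matching n p
      \<and> a < c \<and> c < b \<and> b < d} = ?g ` (pairs_below n - inversions n p)"
    by (auto simp: inversions_def pairs_below_def image_iff)
  moreover have "inj_on ?g (pairs_below n - inversions n p)" by (auto simp: inj_on_def)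
  ultimately show ?thesis by (simp add: cross_def card_image)
qed

lemma cross_plus_nest_perm_matching:
  assumes "p permutes {0..<n}"
  shows "cross (perm_matching n p) + nest (perm_matching n p) = n * (n - 1) div 2"
proof -
  have "inversions n p \<subseteq> pairs_below n" by (auto simp: inversions_def)
  then show ?thesis
    using card_mono[OF finite_pairs_below, of "inversions n p" n] assms
    by (simp only: nest_perm_matching cross_perm_matching card_Diff_subset finite_inversions
        le_add_diff_inverse2 flip: card_pairs_below)
qed

text \<open>With \<open>signof p\<close> equal to \<open>(- 1) ^ nest\<close>, the right-hand side
  has exponent \<open>cross + 2 * nest\<close>, and the even part drops out.\<close>

lemma minus_one_power_cross_perm_matching:
  assumes p: "p permutes {0..<n}"
  shows "(- 1 :: 'a::comm_ring_1) ^ cross (perm_matching n p) = (- 1) ^ (n * (n - 1) div 2) * signof p"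
proof -
  let ?c = "cross (perm_matching n p)" and ?v = "nest (perm_matching n p)"
  have "signof p = (- 1 :: 'a) ^ ?v"
    by (simp add: sign_eq_inversions[OF p] nest_perm_matching)
  then have "(- 1 :: 'a) ^ (n * (n - 1) div 2) * signof p = (- 1) ^ (?c + (?v + ?v))"
    unfolding cross_plus_nest_perm_matching[OF p, symmetric] by (simp only: power_add mult.assoc)
  also have "\<dots> = (- 1) ^ ?c"
    by (simp add: power_add flip: power_mult_distrib)
  finally show ?thesis ..
qed

section \<open>Expansion of the Pfaffian over permutations\<close>

theorem proposition4:
  fixes A :: "'a::comm_ring_1 mat" and l :: 'a and n :: nat
  assumes "A \<in> carrier_mat n n"
  shows "lambda_Pfaffian l
           (four_block_mat (0\<^sub>m n n) A (- transpose_mat A) (0\<^sub>m n n))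
         = (- l) ^ (n * (n - 1) div 2) * det A"
proof -
  let ?B = "four_block_mat (0\<^sub>m n n) A (- transpose_mat A) (0\<^sub>m n n)"
  let ?N = "n * (n - 1) div 2"
  let ?P = "{p. p permutes {0..<n}}"
  let ?w = "\<lambda>m. (- 1) ^ cross m * l ^ (cross m + nest m) * (\<Prod>(a, b) \<in> m. ?B $$ (a, b))"
  have dim: "dim_row ?B = 2 * n" by simp
  have zero: "?w m = 0"
    if m: "m \<in> perfect_matchings {0..<2 * n} - perm_matching n ` ?P" for m
  proof -
    obtain a b where ab: "(a, b) \<in> m" "\<not> (a < n \<and> n \<le> b)"
      using bipartite_matching_is_perm_matching[of m n] m by blast
    have sub: "m \<subseteq> {0..<2 * n} \<times> {0..<2 * n}" and "a < b"
      using m ab(1) by (auto simp: perfect_matchings_def)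
    \<comment> \<open>Since \<open>a < b\<close>, an edge that does not lead from the lower to the
      upper half stays inside one half and so reads an entry of a zero block.\<close>
    have "?B $$ (a, b) = 0"
      using ab sub \<open>a < b\<close> assms by (auto simp: not_le)
    moreover have "finite m" using sub by (rule finite_subset) auto
    ultimately have "(\<Prod>(a, b) \<in> m. ?B $$ (a, b)) = 0"
      using ab(1) by (intro prod_zero) auto
    then show ?thesis by simp
  qed
  have weight: "?w (perm_matching n p) = (- l) ^ ?N * (signof p * (\<Prod>i = 0..<n. A $$ (i, p i)))"
    if p: "p permutes {0..<n}" for p
  proof -
    have "(\<Prod>(a, b) \<in> perm_matching n p. ?B $$ (a, b)) = (\<Prod>i = 0..<n. ?B $$ (i, n + p i))"
      unfolding perm_matching_def by (subst prod.reindex) (auto simp: inj_on_def)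
    also have "\<dots> = (\<Prod>i = 0..<n. A $$ (i, p i))"
      using assms permutes_in_image[OF p] by (intro prod.cong) auto
    \<comment> \<open>The exponent of \<open>l\<close> is the constant \<open>?N\<close>, and
      \<open>(- 1) ^ ?N\<close> from the crossing sign merges with it into
      \<open>(- l) ^ ?N\<close>.\<close>
    finally show ?thesis
      unfolding cross_plus_nest_perm_matching[OF p] minus_one_power_cross_perm_matching[OF p]
        power_minus[of l] by (simp only: ac_simps)
  qed
  have "lambda_Pfaffian l ?B = (\<Sum>m \<in> perfect_matchings {0..<2 * n}. ?w m)"
    unfolding lambda_Pfaffian_def dim ..
  also have "\<dots> = (\<Sum>m \<in> perm_matching n ` ?P. ?w m)"
    using zero perm_matching_in_perfect_matchings
    by (intro sum.mono_neutral_right finite_perfect_matchings) auto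
  also have "\<dots> = (\<Sum>p \<in> ?P. (- l) ^ ?N * (signof p * (\<Prod>i = 0..<n. A $$ (i, p i))))"
    unfolding sum.reindex[OF inj_on_perm_matching] o_def
    by (rule sum.cong[OF refl], rule weight) simp
  \<comment> \<open>The remaining sum is the Leibniz expansion of the determinant.\<close>
  also have "\<dots> = (- l) ^ ?N * det A"
    unfolding det_def'[OF assms] sum_distrib_left ..
  finally show ?thesis .
qed

end
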